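(* Let $f,h:\mathbb{R}^d\to\mathbb{R}$ be twice continuously differentiable with Lipschitz continuous Hessians, with $\nabla f$ Lipschitz continuous with constant $L_f$ and $\nabla h$ Lipschitz continuous with constant $L_h$. Let $g:\mathbb{R}^d\to\mathbb{R}\cup\{+\infty\}$ be proper, lower semicontinuous, prox-bounded with threshold $\gamma_g>0$, and $\rho$-weakly convex, and suppose that $\varphi:=f+g+h$ has a nonempty set of minimisers. Then $\mathbb{R}^d\times\mathbb{R}_{++}\ni(x,\gamma)\mapsto\varphi^{\rm DY}_\gamma(x)$ is an epi-smoothing function of $\varphi$.
   Context: A function $\phi$ is $\rho$-weakly convex ($\rho\ge0$) if $\phi+\frac{\rho}{2}\|\cdot\|^2$ is convex. A function $g$ is prox-bounded with threshold $\gamma_g>0$ if $g+\frac{1}{2\gamma_g}\|\cdot\|^2$ is bounded from below. For $\gamma>0$ the Davis-Yin envelope is $$\varphi_\gamma^{\rm DY}(x):=\inf_{y\in\mathbb{R}^d}\Big\{f(x)+\langle\nabla f(x),y-x\rangle+h(x)+\langle\nabla h(x),y-x\rangle+g(y)+\frac{1}{2\gamma}\|y-x\|^2\Big\},\quad x\in\mathbb{R}^d.$$ For a lower semicontinuous function $\phi$, a function $(x,\gamma)\mapsto s_\phi(x,\gamma)$ is an epi-smoothing function for $\phi$ if (i) $s_\phi(\cdot,\gamma_k)$ epi-converges to $\phi$ for all $\gamma_k\downarrow0$, and (ii) $s_\phi(\cdot,\gamma)$ is continuously differentiable for all $\gamma>0$. A sequence of extended-real-valued functions $\phi^k$ epi-converges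 to $\phi$ if the epigraphs $C^k=\mathrm{epi}(\phi^k)$ set-converge to $C=\mathrm{epi}(\phi)$: $\limsup_k C^k\subseteq C\subseteq\liminf_k C^k$, where $\liminf_k C^k$ is the set of limits of sequences $(x^k)$ with $x^k\in C^k$ for all $k$, and $\limsup_k C^k$ is the set of limits of sequences taken from $C^{k_j}$ along subsequences $(k_j)$.
   Formalization: Continuous differentiability of the envelope is asserted only for γ>0 with ργ<1 (all γ>0 if ρ=0), since for larger γ it can fail: f=x²/2, h=0, g=−x²/2, γ=2 gives −∞; epi-convergence is for all positive γ_k→0. *)

theory Defs
  imports "HOL-Analysis.Analysis"
begin

section \<open>Differentiability of real-valued functions\<close>

definition grad :: "('a::euclidean_space \<Rightarrow> real) \<Rightarrow> 'a \<Rightarrow> 'a" where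
  "grad f x = (THE D. GDERIV f x :> D)"

text \<open>The Hessian is the derivative of the gradient, as a bounded linear operator; continuity and
  Lipschitz continuity of \<open>hessian f\<close> thus refer to the operator norm.\<close>

definition hessian :: "('a::euclidean_space \<Rightarrow> real) \<Rightarrow> 'a \<Rightarrow> 'a \<Rightarrow>\<^sub>L 'a" where
  "hessian f x = Blinfun (frechet_derivative (grad f) (at x))"

definition continuously_differentiable :: "('a::euclidean_space \<Rightarrow> real) \<Rightarrow> bool" where
  "continuously_differentiable f \<longleftrightarrow>
     (\<forall>x. f differentiable (at x)) \<and> continuous_on UNIV (grad f)"

definition twice_continuously_differentiable :: "('a::euclidean_space \<Rightarrow> real) \<Rightarrow> bool" where
  "twice_continuously_differentiable f \<longleftrightarrow>
     (\<forall>x. f differentiable (at x)) \<and> (\<forall>x. grad f differentiable (at x)) \<and>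
     continuous_on UNIV (hessian f)"

text \<open>An extended-real-valued function counts as continuously differentiable on the whole space
  only if it is finite everywhere.\<close>

definition continuously_differentiable_ereal :: "('a::euclidean_space \<Rightarrow> ereal) \<Rightarrow> bool" where
  "continuously_differentiable_ereal \<phi> \<longleftrightarrow>
     (\<exists>F. (\<forall>x. \<phi> x = ereal (F x)) \<and> continuously_differentiable F)"

section \<open>Extended-real-valued functions\<close>

definition proper_fun :: "('a \<Rightarrow> ereal) \<Rightarrow> bool" where
  "proper_fun \<phi> \<longleftrightarrow> (\<forall>x. \<phi> x \<noteq> -\<infinity>) \<and> (\<exists>x. \<phi> x \<noteq> \<infinity>)"

definition lsc_fun :: "('a::topological_space \<Rightarrow> ereal) \<Rightarrow> bool" where
  "lsc_fun \<phi> \<longleftrightarrow> (\<forall>x. \<phi> x \<le> Liminf (at x) \<phi>)"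

text \<open>The library's \<open>epigraph\<close> is for real-valued functions only.\<close>

definition epi :: "('a \<Rightarrow> ereal) \<Rightarrow> ('a \<times> real) set" where
  "epi \<phi> = {(x, \<alpha>). \<phi> x \<le> ereal \<alpha>}"

definition convex_fun :: "('a::real_vector \<Rightarrow> ereal) \<Rightarrow> bool" where
  "convex_fun \<phi> \<longleftrightarrow> convex (epi \<phi>)"

definition weakly_convex :: "real \<Rightarrow> ('a::euclidean_space \<Rightarrow> ereal) \<Rightarrow> bool" where
  "weakly_convex \<rho> \<phi> \<longleftrightarrow> \<rho> \<ge> 0 \<and> convex_fun (\<lambda>x. \<phi> x + ereal (\<rho> / 2 * (norm x)\<^sup>2))"

definition prox_bounded :: "real \<Rightarrow> ('a::euclidean_space \<Rightarrow> ereal) \<Rightarrow> bool" where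
  "prox_bounded \<gamma>g g \<longleftrightarrow>
     \<gamma>g > 0 \<and> (\<exists>m::real. \<forall>x. ereal m \<le> g x + ereal (1 / (2 * \<gamma>g) * (norm x)\<^sup>2))"

section \<open>Epi-convergence and epi-smoothing\<close>

definition set_liminf :: "(nat \<Rightarrow> 'a::topological_space set) \<Rightarrow> 'a set" where
  "set_liminf C = {x. \<exists>xs. (\<forall>k. xs k \<in> C k) \<and> xs \<longlonglongrightarrow> x}"

definition set_limsup :: "(nat \<Rightarrow> 'a::topological_space set) \<Rightarrow> 'a set" where
  "set_limsup C = {x. \<exists>r xs. strict_mono (r :: nat \<Rightarrow> nat) \<and> (\<forall>j. xs j \<in> C (r j)) \<and> xs \<longlonglongrightarrow> x}"

definition epi_converges ::
    "(nat \<Rightarrow> 'a::topological_space \<Rightarrow> ereal) \<Rightarrow> ('a \<Rightarrow> ereal) \<Rightarrow> bool" where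
  "epi_converges \<phi>s \<phi> \<longleftrightarrow>
     set_limsup (\<lambda>k. epi (\<phi>s k)) \<subseteq> epi \<phi> \<and> epi \<phi> \<subseteq> set_liminf (\<lambda>k. epi (\<phi>s k))"

text \<open>Smoothness is required for the parameters in \<open>\<Gamma>\<close>; epi-convergence is required along every
  sequence of positive parameters tending to 0, monotone or not, whether or not its terms lie
  in \<open>\<Gamma>\<close>. Taking \<open>\<Gamma> = {0<..}\<close> asks for smoothness at every positive parameter.\<close>

definition epi_smoothing_on ::
    "real set \<Rightarrow> ('a::euclidean_space \<Rightarrow> ereal) \<Rightarrow> ('a \<Rightarrow> real \<Rightarrow> ereal) \<Rightarrow> bool" where
  "epi_smoothing_on \<Gamma> \<phi> s \<longleftrightarrow>
     lsc_fun \<phi> \<and>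
     (\<forall>\<gamma>s :: nat \<Rightarrow> real. (\<forall>k. \<gamma>s k > 0) \<and> \<gamma>s \<longlonglongrightarrow> 0
        \<longrightarrow> epi_converges (\<lambda>k x. s x (\<gamma>s k)) \<phi>) \<and>
     (\<forall>\<gamma>\<in>\<Gamma>. continuously_differentiable_ereal (\<lambda>x. s x \<gamma>))"

section \<open>The Davis-Yin envelope\<close>

definition DY_envelope ::
    "('a::euclidean_space \<Rightarrow> real) \<Rightarrow> ('a \<Rightarrow> ereal) \<Rightarrow> ('a \<Rightarrow> real) \<Rightarrow> 'a \<Rightarrow> real \<Rightarrow> ereal" where
  "DY_envelope f g h x \<gamma> =
     (INF y. ereal (f x + grad f x \<bullet> (y - x) + h x + grad h x \<bullet> (y - x)) + g y
             + ereal (1 / (2 * \<gamma>) * (norm (y - x))\<^sup>2))"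

end

theory Submission
  imports Defs
begin

text \<open>With \<open>F = f + h\<close> and \<open>w = \<nabla>F\<close>, the envelope equals
  \<open>F x - \<gamma>/2 \<bar>w x\<bar>\<^sup>2 + M (x - \<gamma> w x)\<close>, where \<open>M\<close> is the Moreau envelope of \<open>g\<close> at parameter \<open>\<gamma>\<close>.
  For \<open>\<rho> \<gamma> < 1\<close> the proximal objective is strongly convex, so the proximal map is Lipschitz and
  \<open>M\<close> is continuously differentiable; the chain rule then uses that \<open>w\<close> is \<open>C\<^sup>1\<close>.
  For epi-convergence, \<open>y = x\<close> shows that the envelope lies below \<open>F + g\<close>, which gives the
  liminf inclusion. For the limsup inclusion, the quadratic lower bound on \<open>g\<close> forces almost
  minimising \<open>y\<close> towards \<open>x\<close> as \<open>\<gamma>\<close> tends to 0, and lower semicontinuity concludes.\<close>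

section \<open>Gradients and Hessians as Frechet derivatives\<close>

lemma grad_eqI:
  assumes "GDERIV f x :> D"
  shows "grad f x = D"
  unfolding grad_def
proof (rule the_equality)
  show "GDERIV f x :> D" by fact
next
  fix D' assume "GDERIV f x :> D'"
  with assms have "(\<lambda>v. v \<bullet> D') = (\<lambda>v. v \<bullet> D)"
    unfolding gderiv_def by (metis has_derivative_unique)
  then show "D' = D" unfolding fun_eq_iff by (rule vector_eq_ldot[THEN iffD1])
qed

text \<open>The Riesz vector of the derivative is assembled in the orthonormal basis. Its existence
  makes the definite description in \<open>grad\<close> denote.\<close>

lemma grad_has_derivative:
  assumes "f differentiable (at x)"
  shows "(f has_derivative (\<lambda>v. v \<bullet> grad f x)) (at x)"
proof -
  obtain f' where f': "(f has_derivative f') (at x)"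
    using assms unfolding differentiable_def by blast
  then interpret bounded_linear f' by (rule has_derivative_bounded_linear)
  let ?D = "\<Sum>b\<in>Basis. f' b *\<^sub>R b"
  have "f' v = v \<bullet> ?D" for v
  proof -
    have "f' v = f' (\<Sum>b\<in>Basis. (v \<bullet> b) *\<^sub>R b)" by (simp add: euclidean_representation)
    also have "\<dots> = (\<Sum>b\<in>Basis. (v \<bullet> b) * f' b)" by (simp add: sum scaleR)
    also have "\<dots> = v \<bullet> ?D" by (simp add: inner_sum_right mult.commute)
    finally show ?thesis .
  qed
  then have "f' = (\<lambda>v. v \<bullet> ?D)" by (rule ext)
  with f' have "GDERIV f x :> ?D" by (simp add: gderiv_def)
  then show ?thesis using grad_eqI[of f x ?D] by (simp add: gderiv_def)
qed

lemma hessian_has_derivative: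
  assumes "grad f differentiable (at x)"
  shows "(grad f has_derivative blinfun_apply (hessian f x)) (at x)"
proof -
  have "(grad f has_derivative frechet_derivative (grad f) (at x)) (at x)"
    using assms frechet_derivative_works by blast
  then show ?thesis
    unfolding hessian_def
    by (simp add: bounded_linear_Blinfun_apply has_derivative_bounded_linear)
qed

section \<open>Lower semicontinuity\<close>

text \<open>The punctured neighbourhood can be replaced by the full one because
  \<open>c < \<phi> x\<close> holds at the centre itself.\<close>

lemma lsc_fun_iff:
  "lsc_fun \<phi> \<longleftrightarrow> (\<forall>x. \<forall>c<\<phi> x. eventually (\<lambda>y. c < \<phi> y) (nhds x))"
  unfolding lsc_fun_def le_Liminf_iff eventually_nhds_conv_at by blast

text \<open>This amounts to sequential closedness of the epigraph. A real strictly between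
  \<open>b\<close> and \<open>\<phi> x\<close> would eventually lie below
  \<open>\<phi> (xs n)\<close> and above its bound \<open>a n\<close>.\<close>

lemma lsc_fun_seq_le:
  assumes "lsc_fun \<phi>" "xs \<longlonglongrightarrow> x" "\<And>n. \<phi> (xs n) \<le> ereal (a n)" "a \<longlonglongrightarrow> b"
  shows "\<phi> x \<le> ereal b"
proof (rule ccontr)
  assume "\<not> \<phi> x \<le> ereal b"
  then obtain c where c: "ereal b < ereal c" "ereal c < \<phi> x"
    using ereal_dense2 by (meson not_le_imp_less)
  have "eventually (\<lambda>n. ereal c < \<phi> (xs n)) sequentially"
    using assms(1,2) c(2) unfolding lsc_fun_iff filterlim_iff by blast
  moreover have "eventually (\<lambda>n. a n < c) sequentially"
    using assms(4) c(1) by (simp add: order_tendstoD)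
  ultimately have "eventually (\<lambda>n. False) sequentially"
  proof eventually_elim
    case (elim n)
    with assms(3)[of n] have "ereal c < ereal (a n)" by (meson less_le_trans)
    with elim show False by simp
  qed
  then show False by simp
qed

lemma lsc_fun_add_continuous:
  assumes g: "lsc_fun g" and nb: "\<And>x. g x \<noteq> -\<infinity>" and F: "continuous_on UNIV F"
  shows "lsc_fun (\<lambda>x. g x + ereal (F x))"
  unfolding lsc_fun_iff
proof (intro allI impI)
  fix x c assume c: "c < g x + ereal (F x)"
  show "eventually (\<lambda>y. c < g y + ereal (F y)) (nhds x)"
  proof (cases c)
    case (real r)
    have "ereal (r - F x) < g x"
      using c real by (cases "g x") auto
    \<comment> \<open>The threshold is split in two: semicontinuity keeps \<open>g\<close> above
      \<open>s\<close>, and continuity keeps \<open>F\<close> above \<open>r - s\<close>.\<close>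
    then obtain s where s: "ereal (r - F x) < ereal s" "ereal s < g x"
      using ereal_dense2 by blast
    have "eventually (\<lambda>y. ereal s < g y) (nhds x)"
      using g s(2) by (simp add: lsc_fun_iff)
    moreover have "(F \<longlongrightarrow> F x) (nhds x)"
      using F by (simp add: continuous_on_def flip: tendsto_at_iff_tendsto_nhds)
    then have "eventually (\<lambda>y. r - s < F y) (nhds x)"
      using s(1) by (intro order_tendstoD) auto
    ultimately show ?thesis
    proof eventually_elim
      case (elim y)
      then show ?case using real by (cases "g y") auto
    qed
  next
    case PInf then show ?thesis using c by simp
  next
    case MInf then show ?thesis using nb by (intro always_eventually) (simp add: less_le)
  qed
qed

section \<open>Proximal map and Moreau envelope of a weakly convex function\<close>

text \<open>Real-valued model of the nonsmooth term: \<open>D\<close> is the effective domain and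
  \<open>p\<close> gives the finite values, so all estimates are real arithmetic.
  \<open>closedness\<close> says that the epigraph of \<open>p\<close> over \<open>D\<close> is
  closed.\<close>

locale closed_weakly_convex =
  fixes D :: "'a::euclidean_space set" and p :: "'a \<Rightarrow> real" and \<rho> c m :: real
  assumes dom_nonempty: "D \<noteq> {}"
    and dom_convex: "\<And>x y t. x \<in> D \<Longrightarrow> y \<in> D \<Longrightarrow> 0 \<le> t \<Longrightarrow> t \<le> 1 \<Longrightarrow> (1 - t) *\<^sub>R x + t *\<^sub>R y \<in> D"
    and weak_convexity: "\<And>x y t. x \<in> D \<Longrightarrow> y \<in> D \<Longrightarrow> 0 \<le> t \<Longrightarrow> t \<le> 1 \<Longrightarrow>
      p ((1 - t) *\<^sub>R x + t *\<^sub>R y) + \<rho> / 2 * (norm ((1 - t) *\<^sub>R x + t *\<^sub>R y))\<^sup>2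
      \<le> (1 - t) * (p x + \<rho> / 2 * (norm x)\<^sup>2) + t * (p y + \<rho> / 2 * (norm y)\<^sup>2)"
    and closedness: "\<And>xs x a b. (\<And>n. xs n \<in> D) \<Longrightarrow> xs \<longlonglongrightarrow> x \<Longrightarrow> (\<And>n. p (xs n) \<le> a n) \<Longrightarrow>
      a \<longlonglongrightarrow> b \<Longrightarrow> x \<in> D \<and> p x \<le> b"
    and quadratic_bound: "\<And>x. x \<in> D \<Longrightarrow> m - c * (norm x)\<^sup>2 \<le> p x"
    and c_nonneg: "0 \<le> c" and rho_nonneg: "0 \<le> \<rho>"
begin

text \<open>Convexity propagates the bound on a unit ball around a point of the domain to a bound
  that is linear in the distance, so that any \<open>k > \<rho>\<close>, not only \<open>k > c\<close>, makes the proximal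
  objective bounded below.\<close>

lemma linear_minorant:
  obtains C x0 where "0 \<le> C"
    "\<And>x. x \<in> D \<Longrightarrow> - C * (1 + norm (x - x0)) \<le> p x + \<rho> / 2 * (norm x)\<^sup>2"
proof -
  define G where "G x = p x + \<rho> / 2 * (norm x)\<^sup>2" for x
  obtain x0 where x0: "x0 \<in> D" using dom_nonempty by blast
  define b where "b = \<bar>m\<bar> + c * (norm x0 + 1)\<^sup>2"
  define C where "C = b + \<bar>G x0\<bar>"
  have b0: "0 \<le> b" using c_nonneg by (simp add: b_def)
  have C0: "0 \<le> C" using b0 by (simp add: C_def)
  have ball: "- b \<le> G x" if "x \<in> D" "norm (x - x0) \<le> 1" for x
  proof -
    have "norm x \<le> norm x0 + 1" using that(2) norm_triangle_sub[of x x0] by linarith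
    then have "c * (norm x)\<^sup>2 \<le> c * (norm x0 + 1)\<^sup>2"
      using c_nonneg by (intro mult_left_mono power_mono) auto
    moreover have "0 \<le> \<rho> / 2 * (norm x)\<^sup>2" using rho_nonneg by simp
    ultimately show ?thesis using quadratic_bound[OF that(1)] unfolding G_def b_def by linarith
  qed
  have "- C * (1 + norm (x - x0)) \<le> G x" if x: "x \<in> D" for x
  proof (cases "norm (x - x0) \<le> 1")
    case True
    have "0 \<le> C * norm (x - x0)" using C0 by simp
    with ball[OF x True] show ?thesis by (simp add: C_def algebra_simps)
  next
    case False
    define T where "T = norm (x - x0)"
    have T: "1 < T" using False by (simp add: T_def)
    \<comment> \<open>\<open>z\<close> lies on the segment from \<open>x0\<close> to
      \<open>x\<close> at distance 1 from \<open>x0\<close>. The ball bound holds there, and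
      convexity of \<open>G\<close> carries it outwards to \<open>x\<close> after scaling by
      \<open>T\<close>.\<close>
    define z where "z = (1 - 1/T) *\<^sub>R x0 + (1/T) *\<^sub>R x"
    have "z - x0 = (1/T) *\<^sub>R (x - x0)" by (simp add: z_def algebra_simps)
    then have "norm (z - x0) \<le> 1" using T by (simp add: T_def)
    moreover have "z \<in> D" unfolding z_def using T x x0 by (intro dom_convex) auto
    ultimately have "- b \<le> G z" by (rule ball[rotated])
    also have "G z \<le> (1 - 1/T) * G x0 + (1/T) * G x"
      unfolding G_def z_def using T x x0 by (intro weak_convexity) auto
    finally have "T * (- b) \<le> T * ((1 - 1/T) * G x0 + (1/T) * G x)"
      using T by (intro mult_left_mono) auto
    also have "\<dots> = (T - 1) * G x0 + G x" using T by (simp add: distrib_left left_diff_distrib right_diff_distrib)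
    finally have 1: "- (T * b) \<le> (T - 1) * G x0 + G x" by simp
    have "(T - 1) * G x0 \<le> (T - 1) * \<bar>G x0\<bar>" using T by (intro mult_left_mono) auto
    also have "\<dots> \<le> T * \<bar>G x0\<bar>" by (simp add: algebra_simps)
    finally have "- (T * C) \<le> G x" using 1 by (simp add: C_def algebra_simps)
    then show ?thesis using C0 by (simp add: T_def algebra_simps)
  qed
  then show thesis using that C0 unfolding G_def by blast
qed

text \<open>Here \<open>k\<close> is the reciprocal of the usual Moreau parameter.\<close>

definition prox_objective :: "real \<Rightarrow> 'a \<Rightarrow> 'a \<Rightarrow> real" where
  "prox_objective k u y = p y + k / 2 * (norm (y - u))\<^sup>2"

text \<open>Strong convexity of modulus \<open>k - \<rho>\<close>, tested at midpoints: the
  parallelogram identity gains \<open>k / 8\<close>, used with centre \<open>u\<close>, and weak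
  convexity costs \<open>\<rho> / 8\<close>, from the same identity with centre 0.\<close>

lemma prox_objective_midpoint:
  assumes "x \<in> D" "y \<in> D"
  shows "(1/2) *\<^sub>R x + (1/2) *\<^sub>R y \<in> D"
    and "prox_objective k u ((1/2) *\<^sub>R x + (1/2) *\<^sub>R y)
      \<le> (prox_objective k u x + prox_objective k u y) / 2 - (k - \<rho>) / 8 * (norm (x - y))\<^sup>2"
proof -
  show "(1/2) *\<^sub>R x + (1/2) *\<^sub>R y \<in> D"
    using dom_convex[OF assms, of "1/2"] by simp
  define z where "z = (1/2) *\<^sub>R x + (1/2) *\<^sub>R y"
  have par: "(norm (z - v))\<^sup>2 = ((norm (x - v))\<^sup>2 + (norm (y - v))\<^sup>2) / 2 - (norm (x - y))\<^sup>2 / 4" for v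
    unfolding z_def power2_norm_eq_inner
    by (simp add: inner_add inner_diff inner_commute field_simps)
  have "p z + \<rho> / 2 * (norm z)\<^sup>2
      \<le> (1/2) * (p x + \<rho> / 2 * (norm x)\<^sup>2) + (1/2) * (p y + \<rho> / 2 * (norm y)\<^sup>2)"
    using weak_convexity[OF assms, of "1/2"] by (simp add: z_def)
  then show "prox_objective k u z
      \<le> (prox_objective k u x + prox_objective k u y) / 2 - (k - \<rho>) / 8 * (norm (x - y))\<^sup>2"
    unfolding prox_objective_def par[of u] par[of 0, simplified] by (simp add: field_simps)
qed

lemma prox_objective_bounded_below:
  assumes "\<rho> < k"
  shows "bdd_below (prox_objective k u ` D)"
proof -
  obtain C x0 where C: "0 \<le> C"
      "\<And>x. x \<in> D \<Longrightarrow> - C * (1 + norm (x - x0)) \<le> p x + \<rho> / 2 * (norm x)\<^sup>2"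
    using linear_minorant by blast
  define s where "s = k - \<rho>"
  have s: "0 < s" using assms by (simp add: s_def)
  \<comment> \<open>\<open>A\<close> is the total coefficient of \<open>norm y\<close> from the
    linear minorant and the cross term. Completing the square against
    \<open>s / 2 * (norm y)\<^sup>2\<close> costs the constant
    \<open>A\<^sup>2 / (2 * s)\<close>.\<close>
  define A where "A = C + k * norm u"
  have "- (C * (1 + norm x0) + A\<^sup>2 / (2 * s)) \<le> prox_objective k u y" if y: "y \<in> D" for y
  proof -
    have 1: "- C * (1 + norm x0 + norm y) \<le> - C * (1 + norm (y - x0))"
      using C(1) norm_triangle_ineq4[of y x0] by (intro mult_left_mono_neg) auto
    have "(norm (y - u))\<^sup>2 = (norm y)\<^sup>2 - 2 * (y \<bullet> u) + (norm u)\<^sup>2"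
      unfolding power2_norm_eq_inner by (simp add: inner_diff inner_commute)
    moreover have "y \<bullet> u \<le> norm y * norm u" by (rule norm_cauchy_schwarz)
    ultimately have "(norm y)\<^sup>2 - 2 * (norm y * norm u) \<le> (norm (y - u))\<^sup>2"
      using zero_le_power2[of "norm u"] by linarith
    then have 2: "k / 2 * ((norm y)\<^sup>2 - 2 * (norm y * norm u)) \<le> k / 2 * (norm (y - u))\<^sup>2"
      using assms rho_nonneg by (intro mult_left_mono) auto
    have "0 \<le> (s * norm y - A)\<^sup>2 / (2 * s)" using s by simp
    also have "\<dots> = s / 2 * (norm y)\<^sup>2 - A * norm y + A\<^sup>2 / (2 * s)"
      using s by (simp add: field_simps power2_eq_square)
    finally have 3: "- (A\<^sup>2 / (2 * s)) \<le> s / 2 * (norm y)\<^sup>2 - A * norm y" by simp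
    show ?thesis using C(2)[OF y] 1 2 3
      unfolding prox_objective_def A_def s_def by (simp add: algebra_simps)
  qed
  then show ?thesis by (intro bdd_belowI2)
qed

text \<open>Strong convexity makes a minimising sequence Cauchy, and closedness puts its limit in
  the domain with minimal value.\<close>

lemma prox_exists:
  assumes k: "\<rho> < k"
  shows "\<exists>z\<in>D. \<forall>y\<in>D. prox_objective k u z \<le> prox_objective k u y"
proof -
  define q where "q = prox_objective k u"
  define I where "I = Inf (q ` D)"
  define s where "s = (k - \<rho>) / 8"
  have s: "0 < s" using k by (simp add: s_def)
  have bdd: "bdd_below (q ` D)" unfolding q_def using k by (rule prox_objective_bounded_below)
  have I_le: "I \<le> q y" if "y \<in> D" for y
    unfolding I_def using bdd that by (intro cInf_lower) auto
  have "\<exists>y\<in>D. q y < I + 1 / Suc n" for n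
  proof -
    have "\<exists>r\<in>q ` D. r < I + 1 / Suc n"
      unfolding I_def using dom_nonempty by (intro cInf_lessD) auto
    then show ?thesis by blast
  qed
  then obtain Y where Y: "\<And>n. Y n \<in> D" "\<And>n. q (Y n) < I + 1 / Suc n" by metis
  \<comment> \<open>The midpoint of \<open>Y i\<close> and \<open>Y j\<close> has value at least
    \<open>I\<close>, so the strong convexity gain is at most the mean excess of the two values over
    \<open>I\<close>.\<close>
  have gap: "s * (norm (Y i - Y j))\<^sup>2 \<le> (1 / Suc i + 1 / Suc j) / 2" for i j
  proof -
    have "I \<le> (q (Y i) + q (Y j)) / 2 - s * (norm (Y i - Y j))\<^sup>2"
      using I_le[OF prox_objective_midpoint(1)] prox_objective_midpoint(2) Y(1)
      unfolding q_def s_def by (meson order_trans)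
    moreover have "q (Y i) + q (Y j) \<le> (I + 1 / Suc i) + (I + 1 / Suc j)"
      using Y(2)[of i] Y(2)[of j] by (intro add_mono less_imp_le)
    ultimately show ?thesis by argo
  qed
  have "Cauchy Y"
  proof (rule metric_CauchyI)
    fix e :: real assume e: "0 < e"
    then have "0 < s * e\<^sup>2" using s by simp
    then obtain N where N: "inverse (real (Suc N)) < s * e\<^sup>2" using reals_Archimedean by blast
    have "dist (Y i) (Y j) < e" if "N \<le> i" "N \<le> j" for i j
    proof -
      have "1 / real (Suc i) \<le> 1 / real (Suc N)" "1 / real (Suc j) \<le> 1 / real (Suc N)"
        using that by (auto intro!: divide_left_mono)
      then have "s * (norm (Y i - Y j))\<^sup>2 < s * e\<^sup>2"
        using gap[of i j] N by (simp add: inverse_eq_divide)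
      then have "(norm (Y i - Y j))\<^sup>2 < e\<^sup>2" using s by simp
      then show ?thesis using e by (simp add: dist_norm power2_less_imp_less)
    qed
    then show "\<exists>M. \<forall>m\<ge>M. \<forall>n\<ge>M. dist (Y m) (Y n) < e" by blast
  qed
  then obtain z where z: "Y \<longlonglongrightarrow> z" using Cauchy_convergent convergent_def by blast
  \<comment> \<open>Near-minimality is solved for \<open>p (Y n)\<close>, giving a convergent upper
    bound as \<open>closedness\<close> demands.\<close>
  have lim: "(\<lambda>n. I + 1 / Suc n - k / 2 * (norm (Y n - u))\<^sup>2) \<longlonglongrightarrow> I + 0 - k / 2 * (norm (z - u))\<^sup>2"
    using z LIMSEQ_inverse_real_of_nat
    by (intro tendsto_intros) (simp_all add: inverse_eq_divide)
  have bound: "p (Y n) \<le> I + 1 / Suc n - k / 2 * (norm (Y n - u))\<^sup>2" for n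
    using Y(2)[of n] by (simp add: q_def prox_objective_def)
  have "z \<in> D \<and> p z \<le> I + 0 - k / 2 * (norm (z - u))\<^sup>2"
    by (rule closedness[OF Y(1) z bound lim])
  then have "z \<in> D" "q z \<le> I" by (simp_all add: q_def prox_objective_def)
  then show ?thesis using I_le unfolding q_def by (meson order_trans)
qed

text \<open>For \<open>\<rho> < k\<close> a minimiser exists by \<open>prox_exists\<close>, and
  strong convexity makes it unique, so the choice is canonical.\<close>

definition prox :: "real \<Rightarrow> 'a \<Rightarrow> 'a" where
  "prox k u = (SOME z. z \<in> D \<and> (\<forall>y\<in>D. prox_objective k u z \<le> prox_objective k u y))"

definition moreau :: "real \<Rightarrow> 'a \<Rightarrow> real" where
  "moreau k u = prox_objective k u (prox k u)"

context
  fixes k :: real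
  assumes k: "\<rho> < k"
begin

lemma prox_in_dom: "prox k u \<in> D"
  and moreau_le: "y \<in> D \<Longrightarrow> moreau k u \<le> prox_objective k u y"
proof -
  have "prox k u \<in> D \<and> (\<forall>y\<in>D. prox_objective k u (prox k u) \<le> prox_objective k u y)"
    unfolding prox_def by (rule someI_ex) (use prox_exists[OF k, of u] in blast)
  then show "prox k u \<in> D" "y \<in> D \<Longrightarrow> moreau k u \<le> prox_objective k u y"
    by (simp_all add: moreau_def)
qed

text \<open>The midpoint of \<open>y\<close> and the minimiser cannot beat the minimum. Testing only
  midpoints yields \<open>(k - \<rho>) / 4\<close>, half the sharp constant.\<close>

lemma moreau_quadratic_growth:
  assumes "y \<in> D"
  shows "moreau k u + (k - \<rho>) / 4 * (norm (y - prox k u))\<^sup>2 \<le> prox_objective k u y"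
  using moreau_le[OF prox_objective_midpoint(1)[OF assms prox_in_dom[of u]], of u]
    prox_objective_midpoint(2)[OF assms prox_in_dom[of u], of k u]
  by (simp add: moreau_def field_simps)

text \<open>Moving the centre changes the objective by a function affine in \<open>y\<close>, so
  values of \<open>p\<close> cancel when two centres are compared.\<close>

lemma prox_objective_shift:
  "prox_objective k v y = prox_objective k u y + k * ((u - y) \<bullet> (v - u)) + k / 2 * (norm (v - u))\<^sup>2"
  unfolding prox_objective_def power2_norm_eq_inner
  by (simp add: inner_diff inner_commute algebra_simps)

text \<open>Each proximal point serves as competitor in the other problem. Adding the two growth
  inequalities cancels the objective values up to an inner product, which Cauchy-Schwarz
  bounds.\<close>

lemma prox_lipschitz: "norm (prox k v - prox k u) \<le> 2 * k / (k - \<rho>) * norm (v - u)"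
proof -
  define d where "d = norm (prox k v - prox k u)"
  have k0: "0 \<le> k" using k rho_nonneg by linarith
  have "(k - \<rho>) / 2 * d\<^sup>2 \<le> k * ((prox k v - prox k u) \<bullet> (v - u))"
    using moreau_quadratic_growth[OF prox_in_dom, of u v]
      moreau_quadratic_growth[OF prox_in_dom, of v u]
    unfolding moreau_def d_def prox_objective_shift[of v _ u]
    by (simp add: norm_minus_commute inner_diff algebra_simps)
  also have "\<dots> \<le> k * (d * norm (v - u))"
    unfolding d_def using k0 by (intro mult_left_mono norm_cauchy_schwarz)
  finally have "d * ((k - \<rho>) * d) \<le> d * (2 * k * norm (v - u))"
    by (simp add: power2_eq_square algebra_simps)
  moreover have "0 \<le> 2 * k * norm (v - u)" using k0 by simp
  ultimately have "(k - \<rho>) * d \<le> 2 * k * norm (v - u)"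
    by (cases "d = 0") (auto simp: d_def)
  then show ?thesis using k by (simp add: d_def field_simps)
qed

lemma continuous_on_prox: "continuous_on UNIV (prox k)"
proof -
  have "(2 * k / (k - \<rho>))-lipschitz_on UNIV (prox k)"
    using prox_lipschitz k rho_nonneg by (intro lipschitz_onI) (auto simp: dist_norm)
  then show ?thesis by (rule lipschitz_on_continuous_on)
qed

text \<open>First-order expansion with quadratic remainder and gradient
  \<open>k *\<^sub>R (u - prox k u)\<close>. The upper bound tests the problem at \<open>v\<close>
  with the minimiser at \<open>u\<close>; the lower bound swaps the roles, and the Lipschitz
  estimate controls the discrepancy. No derivative of the proximal map enters.\<close>

lemma moreau_expansion:
  "\<bar>moreau k v - moreau k u - k * ((u - prox k u) \<bullet> (v - u))\<bar>
    \<le> (k * (2 * k / (k - \<rho>)) + k / 2) * (norm (v - u))\<^sup>2"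
proof -
  define R where "R = moreau k v - moreau k u - k * ((u - prox k u) \<bullet> (v - u))"
  have k0: "0 \<le> k" using k rho_nonneg by linarith
  have "moreau k v \<le> prox_objective k v (prox k u)" by (rule moreau_le[OF prox_in_dom])
  then have upper: "R \<le> k / 2 * (norm (v - u))\<^sup>2"
    by (simp add: prox_objective_shift[of v _ u] moreau_def R_def)
  have "moreau k u \<le> prox_objective k u (prox k v)" by (rule moreau_le[OF prox_in_dom])
  also have "\<dots> = moreau k v - k * ((u - prox k v) \<bullet> (v - u)) - k / 2 * (norm (v - u))\<^sup>2"
    by (simp add: prox_objective_shift[of v _ u] moreau_def)
  finally have lower: "k / 2 * (norm (v - u))\<^sup>2 - k * ((prox k v - prox k u) \<bullet> (v - u)) \<le> R"
    by (simp add: R_def inner_diff algebra_simps)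
  have "(prox k v - prox k u) \<bullet> (v - u) \<le> norm (prox k v - prox k u) * norm (v - u)"
    by (rule norm_cauchy_schwarz)
  also have "\<dots> \<le> 2 * k / (k - \<rho>) * norm (v - u) * norm (v - u)"
    using prox_lipschitz by (intro mult_right_mono) auto
  finally have "k * ((prox k v - prox k u) \<bullet> (v - u)) \<le> k * (2 * k / (k - \<rho>) * norm (v - u) * norm (v - u))"
    using k0 by (intro mult_left_mono)
  then have "k * ((prox k v - prox k u) \<bullet> (v - u)) \<le> k * (2 * k / (k - \<rho>)) * (norm (v - u))\<^sup>2"
    by (simp add: power2_eq_square mult.assoc)
  moreover have "0 \<le> k * (2 * k / (k - \<rho>)) * (norm (v - u))\<^sup>2" "0 \<le> k / 2 * (norm (v - u))\<^sup>2"
    using k k0 by auto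
  ultimately show ?thesis
    using upper lower unfolding R_def[symmetric] distrib_right by linarith
qed

lemma moreau_has_derivative:
  "(moreau k has_derivative (\<lambda>v. k * ((u - prox k u) \<bullet> v))) (at u)"
proof -
  define B where "B = k * (2 * k / (k - \<rho>)) + k / 2"
  show ?thesis
    unfolding has_derivative_at2
  proof (intro conjI)
    show "bounded_linear (\<lambda>v. k * ((u - prox k u) \<bullet> v))"
      by (intro bounded_linear_const_mult bounded_linear_inner_right)
    show "((\<lambda>v. (1 / norm (v - u)) *\<^sub>R
        (moreau k v - (moreau k u + k * ((u - prox k u) \<bullet> (v - u))))) \<longlongrightarrow> 0) (at u)"
    proof (rule Lim_null_comparison)
      show "eventually (\<lambda>v. norm ((1 / norm (v - u)) *\<^sub>R
          (moreau k v - (moreau k u + k * ((u - prox k u) \<bullet> (v - u))))) \<le> B * norm (v - u)) (at u)"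
      proof (rule eventually_at_topological[THEN iffD2], intro exI[of _ UNIV] conjI ballI impI)
        fix v assume "v \<noteq> u"
        then show "norm ((1 / norm (v - u)) *\<^sub>R
          (moreau k v - (moreau k u + k * ((u - prox k u) \<bullet> (v - u))))) \<le> B * norm (v - u)"
          using moreau_expansion[of v u] unfolding B_def[symmetric]
          by (simp add: field_simps power2_eq_square)
      qed auto
      have "((\<lambda>v. B * norm (v - u)) \<longlongrightarrow> B * norm (u - u)) (at u)"
        by (intro tendsto_intros)
      then show "((\<lambda>v. B * norm (v - u)) \<longlongrightarrow> 0) (at u)" by simp
    qed
  qed
qed

end

end

section \<open>Passage from extended-real-valued functions to the real model\<close>

lemma closed_weakly_convex_ereal:
  fixes g :: "'a::euclidean_space \<Rightarrow> ereal"
  assumes proper: "proper_fun g" and lsc: "lsc_fun g"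
    and pb: "prox_bounded \<gamma>\<^sub>g g" and wc: "weakly_convex \<rho> g"
  obtains m where "closed_weakly_convex {x. g x \<noteq> \<infinity>} (\<lambda>x. real_of_ereal (g x)) \<rho> (1 / (2 * \<gamma>\<^sub>g)) m"
proof -
  define D where "D = {x. g x \<noteq> \<infinity>}"
  \<comment> \<open>Off \<open>D\<close> this takes the default value 0; every property of
    \<open>p\<close> proved below is claimed only on \<open>D\<close>.\<close>
  define p where "p x = real_of_ereal (g x)" for x
  have gp: "g x = ereal (p x)" if "x \<in> D" for x
    using that proper unfolding D_def p_def proper_fun_def by (cases "g x") auto
  obtain m where m: "ereal m \<le> g x + ereal (1 / (2 * \<gamma>\<^sub>g) * (norm x)\<^sup>2)" for x
    using pb unfolding prox_bounded_def by blast
  have conv: "convex (epi (\<lambda>x. g x + ereal (\<rho> / 2 * (norm x)\<^sup>2)))" and rho: "0 \<le> \<rho>"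
    using wc unfolding weakly_convex_def convex_fun_def by auto
  have wconv: "(1 - t) *\<^sub>R x + t *\<^sub>R y \<in> D \<and>
      p ((1 - t) *\<^sub>R x + t *\<^sub>R y) + \<rho> / 2 * (norm ((1 - t) *\<^sub>R x + t *\<^sub>R y))\<^sup>2
      \<le> (1 - t) * (p x + \<rho> / 2 * (norm x)\<^sup>2) + t * (p y + \<rho> / 2 * (norm y)\<^sup>2)"
    if xy: "x \<in> D" "y \<in> D" and t: "0 \<le> t" "t \<le> 1" for x y t
  proof -
    define G where "G x = p x + \<rho> / 2 * (norm x)\<^sup>2" for x
    define z where "z = (1 - t) *\<^sub>R x + t *\<^sub>R y"
    have "(x, G x) \<in> epi (\<lambda>x. g x + ereal (\<rho> / 2 * (norm x)\<^sup>2))"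
      "(y, G y) \<in> epi (\<lambda>x. g x + ereal (\<rho> / 2 * (norm x)\<^sup>2))"
      using xy by (auto simp: epi_def gp G_def)
    \<comment> \<open>A point of the epigraph has a real height, so this single membership yields
      both convexity of the domain and the inequality for \<open>p\<close>.\<close>
    then have "(1 - t) *\<^sub>R (x, G x) + t *\<^sub>R (y, G y) \<in> epi (\<lambda>x. g x + ereal (\<rho> / 2 * (norm x)\<^sup>2))"
      using conv t by (intro convexD) auto
    then have ep: "g z + ereal (\<rho> / 2 * (norm z)\<^sup>2) \<le> ereal ((1 - t) * G x + t * G y)"
      by (simp add: epi_def z_def)
    then have "z \<in> D" by (auto simp: D_def)
    with ep show ?thesis by (simp add: gp G_def z_def)
  qed
  have "closed_weakly_convex D p \<rho> (1 / (2 * \<gamma>\<^sub>g)) m"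
  proof
    show "D \<noteq> {}" using proper by (auto simp: D_def proper_fun_def)
    show "m - 1 / (2 * \<gamma>\<^sub>g) * (norm x)\<^sup>2 \<le> p x" if "x \<in> D" for x
      using m[of x] gp[OF that] by simp
    have "0 < \<gamma>\<^sub>g" using pb unfolding prox_bounded_def by blast
    then show "0 \<le> 1 / (2 * \<gamma>\<^sub>g)" by simp
    show "x \<in> D \<and> p x \<le> b"
      if "\<And>n. xs n \<in> D" "xs \<longlonglongrightarrow> x" "\<And>n. p (xs n) \<le> a n" "a \<longlonglongrightarrow> b" for xs x a b
    proof -
      have "g x \<le> ereal b"
        using that(1,3) by (intro lsc_fun_seq_le[OF lsc that(2) _ that(4)]) (simp add: gp)
      then have "x \<in> D" by (auto simp: D_def)
      with \<open>g x \<le> ereal b\<close> show ?thesis by (simp add: gp)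
    qed
  qed (use wconv rho in auto)
  then show thesis using that unfolding D_def p_def by blast
qed

section \<open>Upper bound and smoothness of the Davis-Yin envelope\<close>

lemma DY_envelope_le:
  "DY_envelope f g h x \<gamma> \<le> ereal (f x) + g x + ereal (h x)"
  unfolding DY_envelope_def
  by (rule INF_lower2[of x], simp, cases "g x") simp_all

text \<open>The bound \<open>\<rho> * \<gamma> < 1\<close> is \<open>\<rho> < k\<close> for
  \<open>k = 1 / \<gamma>\<close>. Beyond it finiteness can fail: for \<open>\<rho> > 0\<close>, let
  \<open>f\<close> be \<open>\<rho> / 2\<close> times the squared norm, \<open>g\<close> its
  negative and \<open>h = 0\<close>. Then the sum is 0, but the envelope is identically minus
  infinity whenever \<open>\<rho> * \<gamma> > 1\<close>.\<close>

lemma DY_envelope_smooth: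
  fixes f h :: "'a::euclidean_space \<Rightarrow> real" and g :: "'a \<Rightarrow> ereal"
  assumes f: "twice_continuously_differentiable f" and h: "twice_continuously_differentiable h"
    and proper: "proper_fun g" and lsc: "lsc_fun g"
    and pb: "prox_bounded \<gamma>\<^sub>g g" and wc: "weakly_convex \<rho> g"
    and \<gamma>: "0 < \<gamma>" "\<rho> * \<gamma> < 1"
  shows "continuously_differentiable_ereal (\<lambda>x. DY_envelope f g h x \<gamma>)"
proof -
  define D where "D = {x. g x \<noteq> \<infinity>}"
  define p where "p x = real_of_ereal (g x)" for x
  define k where "k = 1 / \<gamma>"
  obtain m where "closed_weakly_convex D p \<rho> (1 / (2 * \<gamma>\<^sub>g)) m"
    using closed_weakly_convex_ereal[OF proper lsc pb wc] unfolding D_def p_def by blast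
  then interpret closed_weakly_convex D p \<rho> "1 / (2 * \<gamma>\<^sub>g)" m .
  have gp: "g x = ereal (p x)" if "x \<in> D" for x
    using that proper unfolding D_def p_def proper_fun_def by (cases "g x") auto
  have k: "\<rho> < k" using \<gamma> by (simp add: k_def field_simps)
  have k\<gamma>: "k * \<gamma> = 1" using \<gamma> by (simp add: k_def)
  define w where "w x = grad f x + grad h x" for x
  define H where "H x = hessian f x + hessian h x" for x
  define U where "U x = x - \<gamma> *\<^sub>R w x" for x
  define E where "E x = f x + h x - \<gamma> / 2 * (w x \<bullet> w x) + moreau k (U x)" for x

  text \<open>Completing the square turns the envelope into a Moreau envelope at the gradient step.\<close>
  have square: "f x + grad f x \<bullet> (y - x) + h x + grad h x \<bullet> (y - x) + p y + 1 / (2 * \<gamma>) * (norm (y - x))\<^sup>2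
      = f x + h x - \<gamma> / 2 * (w x \<bullet> w x) + prox_objective k (U x) y" for x y
  proof -
    have "k / 2 * (norm (y - U x))\<^sup>2
        = k / 2 * (norm (y - x))\<^sup>2 + (k * \<gamma>) * (w x \<bullet> (y - x)) + (k * \<gamma>) * \<gamma> / 2 * (w x \<bullet> w x)"
      unfolding U_def power2_norm_eq_inner
      by (simp add: inner_diff inner_add inner_commute algebra_simps)
    then show ?thesis
      unfolding prox_objective_def k\<gamma> by (simp add: w_def k_def inner_add_left algebra_simps)
  qed
  \<comment> \<open>Points outside \<open>D\<close> contribute infinity; on \<open>D\<close> the
    infimum is attained at the proximal point of \<open>U x\<close>.\<close>
  have DY: "DY_envelope f g h x \<gamma> = ereal (E x)" for x
  proof (rule antisym)
    have "prox k (U x) \<in> D" by (rule prox_in_dom[OF k])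
    then show "DY_envelope f g h x \<gamma> \<le> ereal (E x)"
      unfolding DY_envelope_def
      by (intro INF_lower2[of "prox k (U x)"])
        (simp_all add: gp square E_def moreau_def del: times_divide_eq_left times_divide_eq_right)
    show "ereal (E x) \<le> DY_envelope f g h x \<gamma>"
      unfolding DY_envelope_def
    proof (rule INF_greatest)
      fix y
      show "ereal (E x) \<le> ereal (f x + grad f x \<bullet> (y - x) + h x + grad h x \<bullet> (y - x)) + g y
          + ereal (1 / (2 * \<gamma>) * (norm (y - x))\<^sup>2)"
      proof (cases "y \<in> D")
        case True
        then show ?thesis using moreau_le[OF k True, of "U x"]
          by (simp add: gp square E_def del: times_divide_eq_left times_divide_eq_right)
      next
        case False then show ?thesis by (simp add: D_def)
      qed
    qed
  qed
  have diff: "(f has_derivative (\<lambda>v. v \<bullet> grad f x)) (at x)"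
    "(h has_derivative (\<lambda>v. v \<bullet> grad h x)) (at x)" for x
    using f h by (auto simp: twice_continuously_differentiable_def intro!: grad_has_derivative)
  have w': "(w has_derivative (\<lambda>v. blinfun_apply (H x) v)) (at x)" for x
    unfolding w_def H_def plus_blinfun.rep_eq using f h
    by (intro has_derivative_add hessian_has_derivative)
      (auto simp: twice_continuously_differentiable_def)
  have cw: "continuous_on UNIV w"
    using w' by (meson continuous_at_imp_continuous_on has_derivative_continuous)
  have cH: "continuous_on UNIV H"
    unfolding H_def using f h
    by (intro continuous_on_add) (auto simp: twice_continuously_differentiable_def)
  have cU: "continuous_on UNIV U" unfolding U_def by (intro continuous_intros cw)
  \<comment> \<open>The last summand is the chain rule: the gradient of the Moreau envelope at
    \<open>U x\<close>, paired with the derivative of the gradient step \<open>U\<close>.\<close>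
  define E' where "E' x v = v \<bullet> grad f x + v \<bullet> grad h x - \<gamma> / 2 * (w x \<bullet> H x v + H x v \<bullet> w x)
      + k * ((U x - prox k (U x)) \<bullet> (v - \<gamma> *\<^sub>R H x v))" for x v
  have E_der: "(E has_derivative E' x) (at x)" for x
  proof -
    have "(U has_derivative (\<lambda>v. v - \<gamma> *\<^sub>R H x v)) (at x)"
      unfolding U_def
      by (intro has_derivative_diff has_derivative_ident has_derivative_scaleR_right w')
    then have "((\<lambda>x. moreau k (U x)) has_derivative
        (\<lambda>v. k * ((U x - prox k (U x)) \<bullet> (v - \<gamma> *\<^sub>R H x v)))) (at x)"
      by (rule has_derivative_compose[OF _ moreau_has_derivative[OF k]])
    then show ?thesis
      unfolding E_def E'_def
      by (intro has_derivative_add has_derivative_diff has_derivative_mult_right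
          has_derivative_inner w' diff)
  qed
  have E_diff: "E differentiable (at x)" for x
    using E_der unfolding differentiable_def by blast
  have gradE: "grad E x \<bullet> b = E' x b" for x b
    using has_derivative_unique[OF grad_has_derivative[OF E_diff] E_der]
    by (metis inner_commute)
  \<comment> \<open>In a fixed direction \<open>b\<close>, operator-norm continuity of
    \<open>H\<close> gives continuity of \<open>H x b\<close>; the gradients of \<open>f\<close> and
    \<open>h\<close> are regrouped into \<open>w\<close>.\<close>
  have "continuous_on UNIV (\<lambda>x. grad E x \<bullet> b)" for b
  proof -
    have "E' x b = b \<bullet> w x - \<gamma> / 2 * (w x \<bullet> H x b + H x b \<bullet> w x)
      + k * ((U x - prox k (U x)) \<bullet> (b - \<gamma> *\<^sub>R H x b))" for x
      by (simp add: E'_def w_def inner_add_right)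
    moreover have "continuous_on UNIV (\<lambda>x. prox k (U x))"
      using continuous_on_compose2[OF continuous_on_prox[OF k] cU] by simp
    ultimately show ?thesis
      unfolding gradE by (simp only:) (intro continuous_intros cw cH cU)
  qed
  then have "continuous_on UNIV (grad E)"
    by (subst continuous_on_componentwise) blast
  then show ?thesis
    using DY E_diff unfolding continuously_differentiable_ereal_def continuously_differentiable_def
    by blast
qed

section \<open>The limsup inclusion for epigraphs\<close>

text \<open>Stated for any positive null sequence of parameters, so that it applies directly along
  the subsequences in \<open>set_limsup\<close>.\<close>

lemma DY_envelope_epi_limsup:
  fixes f h :: "'a::euclidean_space \<Rightarrow> real" and g :: "'a \<Rightarrow> ereal"
  assumes cont: "continuous_on UNIV f" "continuous_on UNIV h"
      "continuous_on UNIV (grad f)" "continuous_on UNIV (grad h)"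
    and proper: "proper_fun g" and lsc: "lsc_fun g" and pb: "prox_bounded \<gamma>\<^sub>g g"
    and \<gamma>: "\<And>j. 0 < \<gamma> j" "\<gamma> \<longlonglongrightarrow> 0"
    and lim: "xs \<longlonglongrightarrow> x" "\<alpha> \<longlonglongrightarrow> a"
    and le: "\<And>j. DY_envelope f g h (xs j) (\<gamma> j) \<le> ereal (\<alpha> j)"
  shows "ereal (f x) + g x + ereal (h x) \<le> ereal a"
proof -
  define w where "w x = grad f x + grad h x" for x
  define F where "F x = f x + h x" for x
  define c where "c = 1 / (2 * \<gamma>\<^sub>g)"
  have "0 < \<gamma>\<^sub>g" using pb unfolding prox_bounded_def by blast
  then have c: "0 \<le> c" by (simp add: c_def)
  obtain m where m: "ereal m \<le> g y + ereal (c * (norm y)\<^sup>2)" for y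
    using pb unfolding prox_bounded_def c_def by blast
  \<comment> \<open>The infimum may be unattained or even minus infinity, so a slack
    \<open>1 / Suc j\<close> is allowed. The strict real bound and properness make
    \<open>g y\<close> finite.\<close>
  have "\<exists>y r. g y = ereal r \<and>
      F (xs j) + w (xs j) \<bullet> (y - xs j) + r + 1 / (2 * \<gamma> j) * (norm (y - xs j))\<^sup>2 < \<alpha> j + 1 / Suc j" for j
  proof -
    have "DY_envelope f g h (xs j) (\<gamma> j) < ereal (\<alpha> j + 1 / Suc j)"
      using le[of j] by (rule le_less_trans) simp
    then obtain y where y: "ereal (f (xs j) + grad f (xs j) \<bullet> (y - xs j) + h (xs j)
        + grad h (xs j) \<bullet> (y - xs j)) + g y + ereal (1 / (2 * \<gamma> j) * (norm (y - xs j))\<^sup>2)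
        < ereal (\<alpha> j + 1 / Suc j)"
      unfolding DY_envelope_def INF_less_iff by blast
    moreover obtain r where "g y = ereal r"
      using y proper unfolding proper_fun_def by (cases "g y") auto
    ultimately show ?thesis
      by (intro exI[of _ y] exI[of _ r]) (simp add: F_def w_def inner_add_left algebra_simps)
  qed
  then obtain y r where gr: "\<And>j. g (y j) = ereal (r j)" and
    yr: "\<And>j. F (xs j) + w (xs j) \<bullet> (y j - xs j) + r j + 1 / (2 * \<gamma> j) * (norm (y j - xs j))\<^sup>2
      < \<alpha> j + 1 / Suc j"
    by metis
  have limF: "(\<lambda>j. F (xs j)) \<longlonglongrightarrow> F x" and limw: "(\<lambda>j. w (xs j)) \<longlonglongrightarrow> w x"
    unfolding F_def w_def using cont
    by (auto intro!: tendsto_add continuous_on_tendsto_compose[OF _ lim(1)])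
  have inv0: "(\<lambda>j. 1 / real (Suc j)) \<longlonglongrightarrow> 0"
    using LIMSEQ_inverse_real_of_nat by (simp add: inverse_eq_divide)
  define d where "d j = norm (y j - xs j)" for j
  \<comment> \<open>\<open>A\<close> collects the convergent terms and \<open>B\<close> the
    coefficient of the squared distance. The terms \<open>2 * c\<close> come from bounding the
    squared norm of \<open>y j\<close> by twice the sum of squares, and
    \<open>norm (w (xs j))\<close> enters both through
    \<open>d j \<le> 1 + (d j)\<^sup>2\<close>.\<close>
  define A where "A j = \<alpha> j + 1 / Suc j - F (xs j) - m + norm (w (xs j)) + 2 * c * (norm (xs j))\<^sup>2" for j
  define B where "B j = norm (w (xs j)) + 2 * c" for j
  have est: "1 / (2 * \<gamma> j) * (d j)\<^sup>2 \<le> A j + B j * (d j)\<^sup>2" for j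
  proof -
    have "m \<le> r j + c * (norm (y j))\<^sup>2" using m[of "y j"] by (simp add: gr)
    moreover have "c * (norm (y j))\<^sup>2 \<le> c * (2 * (norm (xs j))\<^sup>2 + 2 * (d j)\<^sup>2)"
    proof -
      have "norm (y j) \<le> norm (xs j) + d j" unfolding d_def by (rule norm_triangle_sub)
      then have "(norm (y j))\<^sup>2 \<le> (norm (xs j) + d j)\<^sup>2" by (intro power_mono) auto
      also have "\<dots> \<le> 2 * (norm (xs j))\<^sup>2 + 2 * (d j)\<^sup>2"
        using sum_squares_bound[of "norm (xs j)" "d j"] by (simp add: power2_sum)
      finally show ?thesis using c by (rule mult_left_mono)
    qed
    moreover have "- (norm (w (xs j)) * (1 + (d j)\<^sup>2)) \<le> w (xs j) \<bullet> (y j - xs j)"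
    proof -
      have "- (w (xs j) \<bullet> (y j - xs j)) \<le> norm (w (xs j)) * d j"
        unfolding d_def using Cauchy_Schwarz_ineq2[of "w (xs j)" "y j - xs j"] by linarith
      also have "\<dots> \<le> norm (w (xs j)) * (1 + (d j)\<^sup>2)"
      proof (rule mult_left_mono)
        have "2 * d j \<le> 1 + (d j)\<^sup>2" using sum_squares_bound[of 1 "d j"] by simp
        then show "d j \<le> 1 + (d j)\<^sup>2" using zero_le_power2[of "d j"] by linarith
      qed simp
      finally show ?thesis by simp
    qed
    ultimately show ?thesis using yr[of j]
      unfolding A_def B_def d_def[symmetric] by (simp add: algebra_simps)
  qed
  have limA: "A \<longlonglongrightarrow> a + 0 - F x - m + norm (w x) + 2 * c * (norm x)\<^sup>2"
    unfolding A_def by (intro tendsto_intros lim limF limw inv0)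
  have limB: "B \<longlonglongrightarrow> norm (w x) + 2 * c"
    unfolding B_def by (intro tendsto_intros limw)
  have d2: "(\<lambda>j. (d j)\<^sup>2) \<longlonglongrightarrow> 0"
  proof (rule tendsto_sandwich[OF _ _ tendsto_const])
    have "(\<lambda>j. 4 * \<gamma> j * A j) \<longlonglongrightarrow> 4 * 0 * (a + 0 - F x - m + norm (w x) + 2 * c * (norm x)\<^sup>2)"
      by (intro tendsto_intros \<gamma> limA)
    then show "(\<lambda>j. 4 * \<gamma> j * A j) \<longlonglongrightarrow> 0" by simp
    have "(\<lambda>j. 4 * \<gamma> j * B j) \<longlonglongrightarrow> 4 * 0 * (norm (w x) + 2 * c)"
      by (intro tendsto_intros \<gamma> limB)
    \<comment> \<open>After scaling \<open>est\<close> by \<open>4 * \<gamma> j\<close>, this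
      absorbs the \<open>B\<close> term into the left side.\<close>
    then have "eventually (\<lambda>j. 4 * \<gamma> j * B j < 1) sequentially"
      by (intro order_tendstoD) auto
    then show "eventually (\<lambda>j. (d j)\<^sup>2 \<le> 4 * \<gamma> j * A j) sequentially"
    proof eventually_elim
      case (elim j)
      have "2 * (d j)\<^sup>2 \<le> 4 * \<gamma> j * A j + (4 * \<gamma> j * B j) * (d j)\<^sup>2"
        using est[of j] \<gamma>(1)[of j] by (simp add: field_simps)
      moreover have "(4 * \<gamma> j * B j) * (d j)\<^sup>2 \<le> 1 * (d j)\<^sup>2"
        using elim by (intro mult_right_mono) auto
      ultimately show ?case by linarith
    qed
  qed auto
  have "d \<longlonglongrightarrow> 0" using tendsto_real_sqrt[OF d2] by (simp add: d_def[abs_def])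
  then have yx: "(\<lambda>j. y j - xs j) \<longlonglongrightarrow> 0"
    unfolding d_def by (rule tendsto_norm_zero_cancel)
  then have "y \<longlonglongrightarrow> x" using tendsto_add[OF yx lim(1)] by simp
  \<comment> \<open>Dropping the nonnegative proximal term leaves a convergent bound on
    \<open>g (y j)\<close>, ready for lower semicontinuity.\<close>
  moreover have "g (y j) \<le> ereal (\<alpha> j + 1 / Suc j - F (xs j) - w (xs j) \<bullet> (y j - xs j))" for j
  proof -
    have "0 \<le> 1 / (2 * \<gamma> j) * (norm (y j - xs j))\<^sup>2" using \<gamma>(1)[of j] by simp
    with yr[of j] show ?thesis unfolding gr by simp
  qed
  moreover have "(\<lambda>j. \<alpha> j + 1 / Suc j - F (xs j) - w (xs j) \<bullet> (y j - xs j))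
      \<longlonglongrightarrow> a + 0 - F x - w x \<bullet> 0"
    by (intro tendsto_intros lim limF limw inv0 yx)
  ultimately have "g x \<le> ereal (a + 0 - F x - w x \<bullet> 0)"
    by (rule lsc_fun_seq_le[OF lsc])
  then show ?thesis by (cases "g x") (auto simp: F_def)
qed

section \<open>Epi-smoothing by the Davis-Yin envelope\<close>

theorem theorem1:
  fixes f h :: "'a::euclidean_space \<Rightarrow> real"
    and g :: "'a \<Rightarrow> ereal"
    and L\<^sub>f L\<^sub>h \<gamma>\<^sub>g \<rho> :: real
  assumes "twice_continuously_differentiable f"
    and "\<exists>M. M-lipschitz_on UNIV (hessian f)"
    and "L\<^sub>f-lipschitz_on UNIV (grad f)"
    and "twice_continuously_differentiable h"
    and "\<exists>M. M-lipschitz_on UNIV (hessian h)"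
    and "L\<^sub>h-lipschitz_on UNIV (grad h)"
    and "proper_fun g"
    and "lsc_fun g"
    and "prox_bounded \<gamma>\<^sub>g g"
    and "weakly_convex \<rho> g"
    and "{x. \<forall>y. ereal (f x) + g x + ereal (h x) \<le> ereal (f y) + g y + ereal (h y)} \<noteq> {}"
  shows "epi_smoothing_on {\<gamma>. 0 < \<gamma> \<and> \<rho> * \<gamma> < 1}
           (\<lambda>x. ereal (f x) + g x + ereal (h x)) (DY_envelope f g h)"
proof -
  let ?\<phi> = "\<lambda>x. ereal (f x) + g x + ereal (h x)"
  have cf: "continuous_on UNIV f" "continuous_on UNIV (grad f)"
    and ch: "continuous_on UNIV h" "continuous_on UNIV (grad h)"
    using assms(1,4) unfolding twice_continuously_differentiable_def
    by (simp_all add: continuous_at_imp_continuous_on differentiable_imp_continuous_within)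
  have "lsc_fun (\<lambda>x. g x + ereal (f x + h x))"
    using assms(7) by (intro lsc_fun_add_continuous assms(8) continuous_on_add cf ch)
      (auto simp: proper_fun_def)
  moreover have "g x + ereal (f x + h x) = ?\<phi> x" for x
    by (cases "g x") auto
  ultimately have "lsc_fun ?\<phi>" by simp
  moreover have "epi_converges (\<lambda>k x. DY_envelope f g h x (\<gamma> k)) ?\<phi>"
    if \<gamma>: "\<And>k. \<gamma> k > 0" "\<gamma> \<longlonglongrightarrow> 0" for \<gamma> :: "nat \<Rightarrow> real"
    unfolding epi_converges_def
  proof (intro conjI subsetI)
    fix z assume "z \<in> set_limsup (\<lambda>k. epi (\<lambda>x. DY_envelope f g h x (\<gamma> k)))"
    then obtain r zs where r: "strict_mono (r :: nat \<Rightarrow> nat)" and zs: "zs \<longlonglongrightarrow> z"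
      and in_epi: "\<And>j. zs j \<in> epi (\<lambda>x. DY_envelope f g h x (\<gamma> (r j)))"
      unfolding set_limsup_def by blast
    have "?\<phi> (fst z) \<le> ereal (snd z)"
    proof (rule DY_envelope_epi_limsup[OF cf(1) ch(1) cf(2) ch(2) assms(7,8,9)])
      show "(\<lambda>j. fst (zs j)) \<longlonglongrightarrow> fst z" "(\<lambda>j. snd (zs j)) \<longlonglongrightarrow> snd z"
        using zs by (auto intro: tendsto_intros)
      show "(\<lambda>j. \<gamma> (r j)) \<longlonglongrightarrow> 0"
        using LIMSEQ_subseq_LIMSEQ[OF \<gamma>(2) r] by (simp add: o_def)
      show "DY_envelope f g h (fst (zs j)) (\<gamma> (r j)) \<le> ereal (snd (zs j))" for j
        using in_epi[of j] by (auto simp: epi_def)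
    qed (rule \<gamma>)
    then show "z \<in> epi ?\<phi>" by (auto simp: epi_def)
  next
    fix z assume "z \<in> epi ?\<phi>"
    then have "z \<in> epi (\<lambda>x. DY_envelope f g h x (\<gamma> k))" for k
      unfolding epi_def using order_trans[OF DY_envelope_le] by auto
    then show "z \<in> set_liminf (\<lambda>k. epi (\<lambda>x. DY_envelope f g h x (\<gamma> k)))"
      \<comment> \<open>The constant sequence works because \<open>z\<close> lies in the epigraph of
        every envelope.\<close>
      unfolding set_liminf_def by (intro CollectI exI[of _ "\<lambda>_. z"]) auto
  qed
  moreover have "continuously_differentiable_ereal (\<lambda>x. DY_envelope f g h x \<gamma>)"
    if "0 < \<gamma>" "\<rho> * \<gamma> < 1" for \<gamma>
    using DY_envelope_smooth assms(1,4,7-10) that by blast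
  ultimately show ?thesis unfolding epi_smoothing_on_def by blast
qed

end
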